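(* For all integers $n, d \ge 0$, the four sets $B_n(d)$, $B_d(n)$, $T_{n,d}$ and $T_{d,n}$ are pairwise in bijection (in particular $|B_n(d)| = |B_d(n)|$).
   Context: $B_n(d)$ is the set of points $(x_1,\dots,x_n) \in \mathbb{Z}^n$ with $\sum_{i=1}^n |x_i| \le d$ ($\mathbb{Z}^0$ is a single point). A tuple-sequence is a finite (possibly empty) list of signed tuples $[\pm(n_1,d_1), \pm(n_2,d_2), \ldots, \pm(n_k,d_k)]$, where each $n_i$ and $d_i$ is a positive integer and each tuple carries a sign $+$ or $-$. Its dimension sum is $\sum_i n_i$ and its distance sum is $\sum_i d_i$. $T_{n,d}$ is the set of tuple-sequences with dimension sum at most $n$ and distance sum at most $d$. *)

theory Defs
  imports Main
begin

(* A point (x_1, ..., x_n) of Z^n is the integer list of length n of its coordinates;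
   Z^0 is the singleton consisting of the empty list. *)
definition l1_ball :: "nat \<Rightarrow> nat \<Rightarrow> int list set" where
  "l1_ball n d = {xs. length xs = n \<and> (\<Sum>x\<leftarrow>xs. \<bar>x\<bar>) \<le> int d}"

datatype sign = Plus | Minus

(* The entry (s, n, d) stands for the signed tuple s(n, d). *)
type_synonym signed_tuple = "sign \<times> nat \<times> nat"

definition tuple_sequence :: "signed_tuple list \<Rightarrow> bool" where
  "tuple_sequence ts \<longleftrightarrow> (\<forall>(s, m, e) \<in> set ts. 0 < m \<and> 0 < e)"

definition dimension_sum :: "signed_tuple list \<Rightarrow> nat" where
  "dimension_sum ts = (\<Sum>(s, m, e)\<leftarrow>ts. m)"

definition distance_sum :: "signed_tuple list \<Rightarrow> nat" where
  "distance_sum ts = (\<Sum>(s, m, e)\<leftarrow>ts. e)"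

definition tuple_sequences :: "nat \<Rightarrow> nat \<Rightarrow> signed_tuple list set" where
  "tuple_sequences n d =
     {ts. tuple_sequence ts \<and> dimension_sum ts \<le> n \<and> distance_sum ts \<le> d}"

end

theory Submission
  imports Defs
begin

text \<open>
  A point of the ball is determined by its nonzero coordinates and their positions. Record each
  nonzero coordinate by its sign, its absolute value (the distance entry) and its offset from the
  previous nonzero coordinate (the dimension entry): the trailing zeros account for the slack
  between the dimension sum and the dimension. Tuple-sequences are manifestly symmetric
  under exchanging the two entries of every tuple, which gives the duality of \<open>n\<close> and \<open>d\<close>.
\<close>

text \<open>The argument \<open>k\<close> counts the zeros read since the last nonzero coordinate.\<close>

fun encode :: "nat \<Rightarrow> int list \<Rightarrow> signed_tuple list" where
  "encode k [] = []"
| "encode k (x # xs) =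
     (if x = 0 then encode (Suc k) xs
      else (if 0 < x then Plus else Minus, Suc k, nat \<bar>x\<bar>) # encode 0 xs)"

fun signed_int :: "sign \<Rightarrow> nat \<Rightarrow> int" where
  "signed_int Plus e = int e"
| "signed_int Minus e = - int e"

text \<open>The number argument is the count of coordinates still to be produced; what remains at
  the end becomes the trailing zeros, which \<open>encode\<close> discards.\<close>

fun decode :: "nat \<Rightarrow> signed_tuple list \<Rightarrow> int list" where
  "decode n [] = replicate n 0"
| "decode n ((s, m, e) # ts) = replicate (m - 1) 0 @ signed_int s e # decode (n - m) ts"

lemma tuple_sequence_simps [simp]:
  "tuple_sequence []"
  "tuple_sequence ((s, m, e) # ts) \<longleftrightarrow> 0 < m \<and> 0 < e \<and> tuple_sequence ts"
  by (auto simp: tuple_sequence_def)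

lemma dimension_sum_simps [simp]:
  "dimension_sum [] = 0"
  "dimension_sum ((s, m, e) # ts) = m + dimension_sum ts"
  by (auto simp: dimension_sum_def)

lemma distance_sum_simps [simp]:
  "distance_sum [] = 0"
  "distance_sum ((s, m, e) # ts) = e + distance_sum ts"
  by (auto simp: distance_sum_def)

lemma abs_signed_int [simp]: "\<bar>signed_int s e\<bar> = int e"
  by (cases s) auto

lemma tuple_sequence_encode: "tuple_sequence (encode k xs)"
  by (induction k xs rule: encode.induct) auto

text \<open>Only an inequality: zeros after the last nonzero coordinate enter no tuple.\<close>

lemma dimension_sum_encode: "dimension_sum (encode k xs) \<le> k + length xs"
  by (induction k xs rule: encode.induct) auto

lemma distance_sum_encode: "int (distance_sum (encode k xs)) = (\<Sum>x\<leftarrow>xs. \<bar>x\<bar>)"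
  by (induction k xs rule: encode.induct) auto

lemma length_decode:
  "tuple_sequence ts \<Longrightarrow> dimension_sum ts \<le> n \<Longrightarrow> length (decode n ts) = n"
  by (induction n ts rule: decode.induct) auto

lemma sum_abs_decode: "(\<Sum>x\<leftarrow>decode n ts. \<bar>x\<bar>) = int (distance_sum ts)"
  by (induction n ts rule: decode.induct) (auto simp: sum_list_replicate)

text \<open>A general \<open>k\<close> is what the induction requires: the pending zeros reappear as
  a prefix.\<close>

lemma decode_encode: "decode (k + length xs) (encode k xs) = replicate k 0 @ xs"
  by (induction k xs rule: encode.induct) (auto simp flip: replicate_append_same)

lemma encode_replicate_zero: "encode k (replicate r 0 @ xs) = encode (k + r) xs"
  by (induction r arbitrary: k) auto

text \<open>Positivity of \<open>e\<close> makes the decoded entry nonzero, so it closes a tuple;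
  positivity of \<open>m\<close> gives \<open>Suc (m - 1) = m\<close>.\<close>

lemma encode_decode: "tuple_sequence ts \<Longrightarrow> encode 0 (decode n ts) = ts"
proof (induction n ts rule: decode.induct)
  case (1 n)
  show ?case using encode_replicate_zero[of 0 n "[]"] by simp
next
  case (2 n s m e ts)
  then show ?case by (cases s) (auto simp: encode_replicate_zero)
qed

lemma bij_betw_encode: "bij_betw (encode 0) (l1_ball n d) (tuple_sequences n d)"
proof (rule bij_betw_byWitness[where f' = "decode n"])
  show "\<forall>xs \<in> l1_ball n d. decode n (encode 0 xs) = xs"
    using decode_encode[of 0] by (auto simp: l1_ball_def)
  show "\<forall>ts \<in> tuple_sequences n d. encode 0 (decode n ts) = ts"
    by (auto simp: tuple_sequences_def encode_decode)
  show "encode 0 ` l1_ball n d \<subseteq> tuple_sequences n d"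
  proof (rule image_subsetI)
    fix xs assume "xs \<in> l1_ball n d"
    then show "encode 0 xs \<in> tuple_sequences n d"
      using dimension_sum_encode[of 0 xs] distance_sum_encode[of 0 xs]
      by (simp add: l1_ball_def tuple_sequences_def tuple_sequence_encode)
  qed
  show "decode n ` tuple_sequences n d \<subseteq> l1_ball n d"
    by (auto simp: l1_ball_def tuple_sequences_def length_decode sum_abs_decode)
qed

fun swap_entries :: "signed_tuple \<Rightarrow> signed_tuple" where
  "swap_entries (s, m, e) = (s, e, m)"

lemma swap_entries_swap_entries: "swap_entries (swap_entries t) = t"
  by (cases t) simp

lemma map_swap_entries_mem:
  assumes "ts \<in> tuple_sequences n d"
  shows "map swap_entries ts \<in> tuple_sequences d n"
proof -
  have "tuple_sequence (map swap_entries ts) = tuple_sequence ts"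
    "dimension_sum (map swap_entries ts) = distance_sum ts"
    "distance_sum (map swap_entries ts) = dimension_sum ts"
    by (induction ts) auto
  then show ?thesis using assms by (simp add: tuple_sequences_def)
qed

lemma bij_betw_map_swap_entries:
  "bij_betw (map swap_entries) (tuple_sequences n d) (tuple_sequences d n)"
  by (rule bij_betw_byWitness[where f' = "map swap_entries"])
    (auto simp: map_swap_entries_mem swap_entries_swap_entries map_idI)

theorem theorem9:
  fixes n d :: nat
  shows "(\<exists>f. bij_betw f (l1_ball n d) (l1_ball d n)) \<and>
         (\<exists>f. bij_betw f (l1_ball n d) (tuple_sequences n d)) \<and>
         (\<exists>f. bij_betw f (l1_ball n d) (tuple_sequences d n)) \<and>
         (\<exists>f. bij_betw f (l1_ball d n) (tuple_sequences n d)) \<and>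
         (\<exists>f. bij_betw f (l1_ball d n) (tuple_sequences d n)) \<and>
         (\<exists>f. bij_betw f (tuple_sequences n d) (tuple_sequences d n)) \<and>
         card (l1_ball n d) = card (l1_ball d n)"
proof -
  \<comment> \<open>Stated for arbitrary \<open>a\<close> and \<open>b\<close> so that it serves
    both \<open>(n, d)\<close> and \<open>(d, n)\<close>.\<close>
  have cross: "\<exists>f. bij_betw f (l1_ball a b) (tuple_sequences b a)" for a b
    using bij_betw_trans[OF bij_betw_encode bij_betw_map_swap_entries] by blast
  \<comment> \<open>Cross over to \<open>tuple_sequences d n\<close>, then return along the inverse
    of \<open>encode 0\<close> on \<open>l1_ball d n\<close>.\<close>
  have balls: "\<exists>f. bij_betw f (l1_ball n d) (l1_ball d n)"
    using cross bij_betw_inv_into[OF bij_betw_encode] bij_betw_trans by blast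
  show ?thesis
    using balls cross bij_betw_encode bij_betw_map_swap_entries bij_betw_same_card by blast
qed

end
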